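(* Let $n\ge 2$ and let $\boldsymbol X=(X_1,\dots,X_n)$ and $\boldsymbol Y=(Y_1,\dots,Y_n)$ be two random vectors with joint distribution functions $F$ and $G$, joint densities, and copulas $C$ and $C'$, respectively, having the same marginal distributions (i.e. $X_i$ and $Y_i$ have the same distribution for each $i=1,\dots,n$), which are continuous and have finite expectations. Let $a_2,\dots,a_n\in[0,1]$ with $\sum_{i=2}^n a_i=1$ be the weights used in the definition of MMME for both vectors. If $C\le_{\rm whr}C'$, then for all $\boldsymbol p_{[-1]}=(p_2,\dots,p_n)\in(0,1)^{n-1}$ (such that the measures below are defined, i.e. $\mathbb E[(X_1-A_{X,\boldsymbol p_{[-1]}})_+]\neq 0$), $$\Delta^{\rm R}{\rm MMME}_{\boldsymbol p_{[-1]}}[X_1|X_2,\dots,X_n]\le \Delta^{\rm R}{\rm MMME}_{\boldsymbol p_{[-1]}}[Y_1|Y_2,\dots,Y_n].$$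
   Context: Throughout, "increasing" means nondecreasing, and $x_+=\max(0,x)$. Value-at-Risk: for a random variable $X$ with distribution function $F_X$ and $p\in(0,1)$, ${\rm VaR}_p[X]=F_X^{-1}(p)=\inf\{x\in\mathbb R: F_X(x)\ge p\}$. Multivariate marginal mean excess and its ratio-based contribution: for $\boldsymbol p_{[-1]}=(p_2,\dots,p_n)\in(0,1)^{n-1}$ and fixed weights $a_2,\dots,a_n\in[0,1]$ with $\sum_{i=2}^n a_i=1$, put $A_{X,\boldsymbol p_{[-1]}}=\sum_{i=2}^n a_i{\rm VaR}_{p_i}[X_i]$. Then $${\rm MMME}_{\boldsymbol p_{[-1]}}[X_1|X_2,\dots,X_n]=\mathbb E\Big[(X_1-A_{X,\boldsymbol p_{[-1]}})_+\,\Big|\,\bigcap_{j=2}^n\{X_j>{\rm VaR}_{p_j}[X_j]\}\Big]$$ (the conditioning event is assumed to have positive probability whenever this is written), and $$\Delta^{\rm R}{\rm MMME}_{\boldsymbol p_{[-1]}}[X_1|X_2,\dots,X_n]=\frac{{\rm MMME}_{\boldsymbol p_{[-1]}}[X_1|X_2,\dots,X_n]-\mathbb E[(X_1-A_{X,\boldsymbol p_{[-1]}})_+]}{\mathbb E[(X_1-A_{X,\boldsymbol p_{[-1]}})_+]},$$ defined when $\mathbb E[(X_1-A_{X,\boldsymbol p_{[-1]}})_+]\ne0$. The same definitions apply to $\boldsymbol Y$ with the same weights. Copula: the copula $C$ of $\boldsymbol X$, with marginal distribution functions $F_1,\dots,F_n$, is the joint distribution function on $[0,1]^n$ of $(U_1,\dots,U_n)$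 with $U_i=F_i(X_i)$, so $F(x_1,\dots,x_n)=C(F_1(x_1),\dots,F_n(x_n))$. Its joint tail function is $\overline C(p_1,\dots,p_n)=\mathbb P(U_1>p_1,\dots,U_n>p_n)$. Similarly $C'$, $\overline{C'}$ for $\boldsymbol Y$. Weak multivariate hazard rate order for copulas: $C\le_{\rm whr}C'$ means that $\overline{C'}(\boldsymbol p)/\overline C(\boldsymbol p)$ is increasing in $\boldsymbol p$ (componentwise) on $\{\boldsymbol p\in[0,1]^n:\overline C(\boldsymbol p)>0\}$. *)

theory Defs
  imports "HOL-Probability.Probability"
begin

text \<open>
  A random vector (X_1, ..., X_n) on a probability space M is a family
  \<open>X :: nat \<Rightarrow> 'a \<Rightarrow> real\<close> of which only the members with index in \<open>{1..n}\<close> matter.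
  The law of a vector lives on the product \<open>\<Pi>\<^sub>M i\<in>{1..n}. borel\<close>.
\<close>

definition random_vec :: "nat \<Rightarrow> (nat \<Rightarrow> 'a \<Rightarrow> real) \<Rightarrow> 'a \<Rightarrow> nat \<Rightarrow> real" where
  "random_vec n X \<omega> = (\<lambda>i\<in>{1..n}. X i \<omega>)"

definition marginal_cdf :: "'a measure \<Rightarrow> ('a \<Rightarrow> real) \<Rightarrow> real \<Rightarrow> real" where
  "marginal_cdf M Z = cdf (distr M borel Z)"

definition VaR :: "'a measure \<Rightarrow> real \<Rightarrow> ('a \<Rightarrow> real) \<Rightarrow> real" where
  "VaR M p Z = Inf {x. marginal_cdf M Z x \<ge> p}"

definition threshold ::
  "'a measure \<Rightarrow> nat \<Rightarrow> (nat \<Rightarrow> real) \<Rightarrow> (nat \<Rightarrow> real) \<Rightarrow> (nat \<Rightarrow> 'a \<Rightarrow> real) \<Rightarrow> real" where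
  "threshold M n a p X = (\<Sum>i=2..n. a i * VaR M (p i) (X i))"

definition stress_event ::
  "'a measure \<Rightarrow> nat \<Rightarrow> (nat \<Rightarrow> real) \<Rightarrow> (nat \<Rightarrow> 'a \<Rightarrow> real) \<Rightarrow> 'a set" where
  "stress_event M n p X = {\<omega> \<in> space M. \<forall>j\<in>{2..n}. X j \<omega> > VaR M (p j) (X j)}"

definition mean_excess ::
  "'a measure \<Rightarrow> nat \<Rightarrow> (nat \<Rightarrow> real) \<Rightarrow> (nat \<Rightarrow> real) \<Rightarrow> (nat \<Rightarrow> 'a \<Rightarrow> real) \<Rightarrow> real" where
  "mean_excess M n a p X = (\<integral>\<omega>. max 0 (X 1 \<omega> - threshold M n a p X) \<partial>M)"

text \<open>
  The expectation given an event A of positive probability is the integral with respect to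
  \<open>uniform_measure M A\<close>, the measure with B mapped to P(A \<inter> B) / P(A).
\<close>

definition MMME ::
  "'a measure \<Rightarrow> nat \<Rightarrow> (nat \<Rightarrow> real) \<Rightarrow> (nat \<Rightarrow> real) \<Rightarrow> (nat \<Rightarrow> 'a \<Rightarrow> real) \<Rightarrow> real" where
  "MMME M n a p X =
     (\<integral>\<omega>. max 0 (X 1 \<omega> - threshold M n a p X) \<partial>(uniform_measure M (stress_event M n p X)))"

definition Delta_R_MMME ::
  "'a measure \<Rightarrow> nat \<Rightarrow> (nat \<Rightarrow> real) \<Rightarrow> (nat \<Rightarrow> real) \<Rightarrow> (nat \<Rightarrow> 'a \<Rightarrow> real) \<Rightarrow> real" where
  "Delta_R_MMME M n a p X =
     (MMME M n a p X - mean_excess M n a p X) / mean_excess M n a p X"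

text \<open>
  A copula is represented by the law of (U_1, ..., U_n) with U_i = F_i(X_i), that is, by the
  probability measure whose joint distribution function is the copula; the joint tail
  function is then read off directly.
\<close>

definition copula ::
  "'a measure \<Rightarrow> nat \<Rightarrow> (nat \<Rightarrow> 'a \<Rightarrow> real) \<Rightarrow> (nat \<Rightarrow> real) measure" where
  "copula M n X = distr M (\<Pi>\<^sub>M i\<in>{1..n}. borel)
     (random_vec n (\<lambda>i \<omega>. marginal_cdf M (X i) (X i \<omega>)))"

definition joint_tail :: "nat \<Rightarrow> (nat \<Rightarrow> real) measure \<Rightarrow> (nat \<Rightarrow> real) \<Rightarrow> real" where
  "joint_tail n C p = measure C {u \<in> space C. \<forall>i\<in>{1..n}. u i > p i}"

definition whr_le :: "nat \<Rightarrow> (nat \<Rightarrow> real) measure \<Rightarrow> (nat \<Rightarrow> real) measure \<Rightarrow> bool" where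
  "whr_le n C C' \<longleftrightarrow>
     (\<forall>p q. (\<forall>i\<in>{1..n}. p i \<in> {0..1} \<and> q i \<in> {0..1} \<and> p i \<le> q i) \<and>
        joint_tail n C p > 0 \<and> joint_tail n C q > 0 \<longrightarrow>
        joint_tail n C' p / joint_tail n C p \<le> joint_tail n C' q / joint_tail n C q)"

end

theory Submission
  imports Defs
begin

text \<open>
  Both vectors share the thresholds \<open>VaR\<close> and the unconditional mean excess, so only the
  conditional mean excesses have to be compared. Given the stress event, the first component of
  the second vector is stochastically larger: for continuous marginals, almost surely
  \<open>U\<^sub>j > p\<^sub>j\<close> iff \<open>X\<^sub>j\<close> exceeds its Value-at-Risk, and \<open>U\<^sub>1 > F\<^sub>1(t)\<close> iff \<open>X\<^sub>1 > t\<close>, so the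
  comparison of the conditional tails at \<open>t\<close> is the monotonicity of the ratio of joint tails
  between \<open>(0, p\<^sub>2, ..., p\<^sub>n)\<close> and \<open>(F\<^sub>1(t), p\<^sub>2, ..., p\<^sub>n)\<close>.
\<close>

section \<open>Layer-cake formula and stochastic comparison of expectations\<close>

text \<open>The nonnegative part of \<open>U \<omega>\<close> is the length of
  \<open>{0..<U \<omega>}\<close>, and exchanging the order of integration turns lengths into tail
  probabilities. Negative values agree on both sides: \<open>ennreal\<close> sends them to 0 and the
  interval is empty.\<close>

lemma nn_integral_eq_tail_integral:
  fixes U :: "'a \<Rightarrow> real"
  assumes "sigma_finite_measure M" and [measurable]: "U \<in> borel_measurable M"
  shows "(\<integral>\<^sup>+\<omega>. ennreal (U \<omega>) \<partial>M) =
    (\<integral>\<^sup>+t. emeasure M {\<omega> \<in> space M. t < U \<omega>} * indicator {0..} t \<partial>lborel)"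
proof -
  interpret M: sigma_finite_measure M by fact
  interpret pair_sigma_finite M lborel ..
  \<comment> \<open>The layer is written as the indicator of a fixed set of pairs, so that joint
    measurability in \<open>t\<close> and \<open>\<omega>\<close> is immediate for
    \<open>Fubini'\<close>.\<close>
  have "(\<integral>\<^sup>+\<omega>. ennreal (U \<omega>) \<partial>M) =
      (\<integral>\<^sup>+\<omega>. (\<integral>\<^sup>+t. indicator {(t, x). 0 \<le> t \<and> t < x} (t, U \<omega>) \<partial>lborel) \<partial>M)"
  proof (rule nn_integral_cong)
    fix \<omega>
    have "(\<integral>\<^sup>+t. indicator {(t, x). 0 \<le> t \<and> t < x} (t, U \<omega>) \<partial>lborel) =
        (\<integral>\<^sup>+t. indicator {0..<U \<omega>} t \<partial>lborel)"
      by (intro nn_integral_cong) (auto simp: indicator_def)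
    also have "\<dots> = ennreal (U \<omega>)"
      by (cases "0 \<le> U \<omega>") (simp_all add: ennreal_neg)
    finally show "ennreal (U \<omega>) =
      (\<integral>\<^sup>+t. indicator {(t, x). 0 \<le> t \<and> t < x} (t, U \<omega>) \<partial>lborel)" ..
  qed
  also have "\<dots> = (\<integral>\<^sup>+t. (\<integral>\<^sup>+\<omega>. indicator {(t, x). 0 \<le> t \<and> t < x} (t, U \<omega>) \<partial>M) \<partial>lborel)"
    by (rule Fubini'[symmetric]) measurable
  also have "\<dots> = (\<integral>\<^sup>+t. emeasure M {\<omega> \<in> space M. t < U \<omega>} * indicator {0..} t \<partial>lborel)"
  proof (rule nn_integral_cong)
    fix t :: real
    have "(\<integral>\<^sup>+\<omega>. indicator {(t, x). 0 \<le> t \<and> t < x} (t, U \<omega>) \<partial>M) =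
        (\<integral>\<^sup>+\<omega>. indicator {0..} t * indicator {\<omega> \<in> space M. t < U \<omega>} \<omega> \<partial>M)"
      by (intro nn_integral_cong) (auto simp: indicator_def)
    then show "(\<integral>\<^sup>+\<omega>. indicator {(t, x). 0 \<le> t \<and> t < x} (t, U \<omega>) \<partial>M) =
        emeasure M {\<omega> \<in> space M. t < U \<omega>} * indicator {0..} t"
      by (simp add: nn_integral_cmult_indicator mult.commute)
  qed
  finally show ?thesis .
qed

text \<open>By the layer-cake formula the extended integrals compare tail by tail. Integrability of
  \<open>V\<close> makes the upper one finite, which is what carries the inequality over to
  real-valued integrals.\<close>

lemma integral_mono_stochastic:
  fixes U :: "'a \<Rightarrow> real" and V :: "'b \<Rightarrow> real"
  assumes M: "prob_space M" and N: "prob_space N"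
    and U[measurable]: "U \<in> borel_measurable M" and V: "integrable N V"
    and nonneg: "\<And>\<omega>. 0 \<le> U \<omega>" "\<And>\<omega>. 0 \<le> V \<omega>"
    and tail: "\<And>t. 0 \<le> t \<Longrightarrow>
      measure M {\<omega> \<in> space M. t < U \<omega>} \<le> measure N {\<omega> \<in> space N. t < V \<omega>}"
  shows "(\<integral>\<omega>. U \<omega> \<partial>M) \<le> (\<integral>\<omega>. V \<omega> \<partial>N)"
proof -
  interpret M: prob_space M by fact
  interpret N: prob_space N by fact
  have [measurable]: "V \<in> borel_measurable N" using V by simp
  have "(\<integral>\<^sup>+\<omega>. ennreal (U \<omega>) \<partial>M) \<le> (\<integral>\<^sup>+\<omega>. ennreal (V \<omega>) \<partial>N)"
    unfolding nn_integral_eq_tail_integral[OF M.sigma_finite_measure_axioms U]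
      nn_integral_eq_tail_integral[OF N.sigma_finite_measure_axioms \<open>V \<in> borel_measurable N\<close>]
    by (intro nn_integral_mono)
      (auto simp: indicator_def M.emeasure_eq_measure N.emeasure_eq_measure tail intro: ennreal_leI)
  moreover have "(\<integral>\<^sup>+\<omega>. ennreal (V \<omega>) \<partial>N) < top"
    using V nonneg by (simp add: nn_integral_eq_integral)
  ultimately show ?thesis
    using nonneg V by (simp add: integral_eq_nn_integral enn2real_mono)
qed

section \<open>Continuous distribution functions on the real line\<close>

context real_distribution
begin

lemma cdf_attains:
  assumes cont: "continuous_on UNIV (cdf M)" and p: "0 < p" "p < 1"
  obtains c where "cdf M c = p"
proof -
  have "eventually (\<lambda>x. cdf M x < p) at_bot"
    using cdf_lim_at_bot p(1) by (rule order_tendstoD)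
  then obtain l where l: "cdf M l < p" by (auto simp: eventually_at_bot_linorder)
  have "eventually (\<lambda>x. p < cdf M x) at_top"
    using cdf_lim_at_top_prob p(2) by (rule order_tendstoD)
  then obtain u where u: "p < cdf M u" by (auto simp: eventually_at_top_linorder)
  have "l \<le> u" using l u cdf_nondecreasing[of u l] by (cases "l \<le> u") auto
  then have "\<exists>c. l \<le> c \<and> c \<le> u \<and> cdf M c = p"
    using l u cont by (intro IVT') (auto intro: continuous_on_subset)
  then show ?thesis using that by blast
qed

text \<open>By continuity the superlevel set is closed, so its infimum belongs to it and has value
  at least \<open>p\<close>. A point \<open>c\<close> with value exactly \<open>p\<close> lies in
  the set, so monotonicity gives the other inequality.\<close>

lemma cdf_quantile:
  assumes cont: "continuous_on UNIV (cdf M)" and p: "0 < p" "p < 1"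
  shows "cdf M (Inf {x. p \<le> cdf M x}) = p"
proof -
  let ?A = "{x. p \<le> cdf M x}"
  obtain c where c: "cdf M c = p" using cdf_attains[OF cont p] .
  have "eventually (\<lambda>x. cdf M x < p) at_bot"
    using cdf_lim_at_bot p(1) by (rule order_tendstoD)
  then obtain l where l: "cdf M l < p" by (auto simp: eventually_at_bot_linorder)
  have bdd: "bdd_below ?A"
  proof (rule bdd_belowI)
    fix x assume "x \<in> ?A"
    then show "l \<le> x" using l cdf_nondecreasing[of x l] by (cases "l \<le> x") auto
  qed
  have "closed ?A" using cont by (intro closed_Collect_le) auto
  then have "Inf ?A \<in> ?A" using c bdd by (intro closed_contains_Inf) auto
  moreover have "cdf M (Inf ?A) \<le> p"
    using cInf_lower[OF _ bdd, of c] c cdf_nondecreasing[of "Inf ?A" c] by auto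
  ultimately show ?thesis by auto
qed

text \<open>The implication from left to right is monotonicity. The converse fails only where the
  distribution function stays flat to the right of \<open>c\<close>, and a flat piece carries no
  mass. The cases are whether that piece ends.\<close>

lemma AE_cdf_less_iff:
  assumes cont: "continuous_on UNIV (cdf M)"
  shows "AE x in M. cdf M c < cdf M x \<longleftrightarrow> c < x"
proof -
  let ?A = "{x. cdf M x \<le> cdf M c}"
  have "AE x in M. \<not> (c < x \<and> cdf M x \<le> cdf M c)"
  proof (cases "bdd_above ?A")
    case True
    have "closed ?A" using cont by (intro closed_Collect_le) auto
    then have "Sup ?A \<in> ?A" using True by (intro closed_contains_Sup) auto
    have "c \<le> Sup ?A" using True by (intro cSup_upper) auto
    then have "measure M {c<..Sup ?A} = 0"
      using \<open>Sup ?A \<in> ?A\<close> cdf_diff_eq[of c "Sup ?A"] measure_nonneg[of M "{c<..Sup ?A}"]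
        \<open>c \<le> Sup ?A\<close>
      by (cases "c = Sup ?A") (auto intro: order_antisym)
    then have "AE x in M. x \<notin> {c<..Sup ?A}"
      by (intro AE_I'[of "{c<..Sup ?A}"]) (auto simp: null_sets_def emeasure_eq_measure)
    then show ?thesis
      using cSup_upper[OF _ True] by (elim eventually_mono) auto
  next
    case False
    \<comment> \<open>An endless flat piece bounds the whole function by its value at
      \<open>c\<close>. The limit 1 at infinity then puts full mass on \<open>{..c}\<close>.\<close>
    have "cdf M x \<le> cdf M c" for x
    proof -
      obtain y where "y \<in> ?A" "x \<le> y" using False
        by (auto simp: bdd_above_def not_le intro: less_imp_le)
      then show ?thesis using cdf_nondecreasing[of x y] by auto
    qed
    then have "1 \<le> cdf M c"
      by (intro tendsto_upperbound[OF cdf_lim_at_top_prob]) auto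
    then have "AE x in M. x \<in> {..c}"
      by (intro AE_prob_1) (use prob_le_1[of "{..c}"] in \<open>auto simp: cdf_def\<close>)
    then show ?thesis by (elim eventually_mono) auto
  qed
  then show ?thesis
  proof eventually_elim
    case (elim x)
    then show ?case using cdf_nondecreasing[of x c] by (cases "c < x") auto
  qed
qed

text \<open>Almost every zero of the distribution function lies below any given \<open>c\<close>, so
  the zero set has mass at most \<open>cdf M c\<close>, which tends to 0 as \<open>c\<close> tends
  to minus infinity.\<close>

lemma AE_cdf_pos:
  assumes cont: "continuous_on UNIV (cdf M)"
  shows "AE x in M. 0 < cdf M x"
proof -
  have [measurable]: "cdf M \<in> borel_measurable borel"
    using cont by (rule borel_measurable_continuous_onI)
  have "measure M {x \<in> space M. \<not> 0 < cdf M x} \<le> cdf M c" for c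
  proof -
    have "AE x in M. x \<in> {x \<in> space M. \<not> 0 < cdf M x} \<longrightarrow> x \<in> {..c}"
      using AE_cdf_less_iff[OF cont, of c]
    proof eventually_elim
      case (elim x)
      then show ?case using cdf_nonneg[of c] by auto
    qed
    then show ?thesis unfolding cdf_def by (intro finite_measure_mono_AE) auto
  qed
  then have "measure M {x \<in> space M. \<not> 0 < cdf M x} \<le> 0"
    by (intro tendsto_lowerbound[OF cdf_lim_at_bot]) auto
  then have "measure M {x \<in> space M. \<not> 0 < cdf M x} = 0"
    using measure_nonneg[of M] by (metis order_antisym)
  then show ?thesis
    by (subst AE_iff_measurable[OF _ refl]) (auto simp: emeasure_eq_measure)
qed

end

section \<open>Joint tails of the copula as probabilities of events\<close>

context prob_space
begin

lemma marginal_cdf_VaR: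
  assumes Z: "random_variable borel Z" and cont: "continuous_on UNIV (marginal_cdf M Z)"
    and "0 < p" "p < 1"
  shows "marginal_cdf M Z (VaR M p Z) = p"
proof -
  interpret D: real_distribution "distr M borel Z" using Z by simp
  show ?thesis
    using D.cdf_quantile assms unfolding VaR_def marginal_cdf_def by blast
qed

lemma AE_marginal_cdf_less_iff:
  assumes Z: "random_variable borel Z" and cont: "continuous_on UNIV (marginal_cdf M Z)"
  shows "AE \<omega> in M. marginal_cdf M Z c < marginal_cdf M Z (Z \<omega>) \<longleftrightarrow> c < Z \<omega>"
proof -
  interpret D: real_distribution "distr M borel Z" using Z by simp
  show ?thesis
    using AE_distrD[OF Z D.AE_cdf_less_iff] cont unfolding marginal_cdf_def by blast
qed

lemma AE_marginal_cdf_pos: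
  assumes Z: "random_variable borel Z" and cont: "continuous_on UNIV (marginal_cdf M Z)"
  shows "AE \<omega> in M. 0 < marginal_cdf M Z (Z \<omega>)"
proof -
  interpret D: real_distribution "distr M borel Z" using Z by simp
  show ?thesis
    using AE_distrD[OF Z D.AE_cdf_pos] cont unfolding marginal_cdf_def by blast
qed

text \<open>The event \<open>A\<close> only has to agree almost surely with the tail event of the
  uniforms. This absorbs the null sets on which \<open>U\<^sub>i > F\<^sub>i(c)\<close> and
  \<open>X\<^sub>i > c\<close> differ.\<close>

lemma joint_tail_copula:
  assumes X: "\<And>i. i \<in> {1..n} \<Longrightarrow> random_variable borel (X i)"
    and cont: "\<And>i. i \<in> {1..n} \<Longrightarrow> continuous_on UNIV (marginal_cdf M (X i))"
    and A: "A \<in> events"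
    and AE: "AE \<omega> in M. (\<forall>i\<in>{1..n}. q i < marginal_cdf M (X i) (X i \<omega>)) \<longleftrightarrow> \<omega> \<in> A"
  shows "joint_tail n (copula M n X) q = prob A"
proof -
  let ?U = "random_vec n (\<lambda>i \<omega>. marginal_cdf M (X i) (X i \<omega>))"
  let ?P = "\<Pi>\<^sub>M i\<in>{1..n}. (borel :: real measure)"
  have U: "(\<lambda>\<omega>. marginal_cdf M (X i) (X i \<omega>)) \<in> borel_measurable M" if "i \<in> {1..n}" for i
    using measurable_compose[OF X[OF that] borel_measurable_continuous_onI[OF cont[OF that]]] .
  have vec: "?U \<in> measurable M ?P"
    unfolding random_vec_def[abs_def] using U by (intro measurable_restrict) auto
  have "{u \<in> space ?P. \<forall>i\<in>{1..n}. q i < u i} \<in> sets ?P"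
    by measurable
  then have "joint_tail n (copula M n X) q =
      prob (?U -` {u \<in> space ?P. \<forall>i\<in>{1..n}. q i < u i} \<inter> space M)"
    unfolding joint_tail_def copula_def space_distr by (intro measure_distr vec)
  also have "?U -` {u \<in> space ?P. \<forall>i\<in>{1..n}. q i < u i} \<inter> space M =
      {\<omega> \<in> space M. \<forall>i\<in>{1..n}. q i < marginal_cdf M (X i) (X i \<omega>)}"
    by (auto simp: random_vec_def space_PiM)
  also have "prob \<dots> = prob A"
  proof (rule finite_measure_eq_AE)
    show "{\<omega> \<in> space M. \<forall>i\<in>{1..n}. q i < marginal_cdf M (X i) (X i \<omega>)} \<in> events"
      using U by (intro sets.sets_Collect_finite_All borel_measurable_less) auto
    show "AE \<omega> in M. \<omega> \<in> {\<omega> \<in> space M. \<forall>i\<in>{1..n}. q i < marginal_cdf M (X i) (X i \<omega>)}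
        \<longleftrightarrow> \<omega> \<in> A"
      using AE AE_space by eventually_elim auto
  qed (fact A)
  finally show ?thesis .
qed

lemma stress_event_sets:
  assumes "\<And>i. i \<in> {1..n} \<Longrightarrow> random_variable borel (X i)"
  shows "stress_event M n p X \<in> events"
  unfolding stress_event_def using assms
  by (intro sets.sets_Collect_finite_All borel_measurable_less) auto

context
  fixes n :: nat and X :: "nat \<Rightarrow> 'a \<Rightarrow> real" and p :: "nat \<Rightarrow> real"
  assumes n: "2 \<le> n"
    and X: "\<And>i. i \<in> {1..n} \<Longrightarrow> random_variable borel (X i)"
    and cont: "\<And>i. i \<in> {1..n} \<Longrightarrow> continuous_on UNIV (marginal_cdf M (X i))"
    and p: "\<And>i. i \<in> {2..n} \<Longrightarrow> p i \<in> {0<..<1}"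
begin

text \<open>Each \<open>p i\<close> is the marginal distribution function at the Value-at-Risk, so
  the one-dimensional equivalence applies there. Finitely many exceptional null sets are
  combined.\<close>

lemma AE_stress_event_iff:
  "AE \<omega> in M. (\<forall>i\<in>{2..n}. p i < marginal_cdf M (X i) (X i \<omega>)) \<longleftrightarrow>
    \<omega> \<in> stress_event M n p X"
proof -
  have "AE \<omega> in M. \<forall>i\<in>{2..n}. p i < marginal_cdf M (X i) (X i \<omega>) \<longleftrightarrow>
      VaR M (p i) (X i) < X i \<omega>"
  proof (rule AE_finite_allI)
    fix i assume i: "i \<in> {2..n}"
    then have "marginal_cdf M (X i) (VaR M (p i) (X i)) = p i"
      using p[OF i] X cont by (intro marginal_cdf_VaR) auto
    then show "AE \<omega> in M. p i < marginal_cdf M (X i) (X i \<omega>) \<longleftrightarrow> VaR M (p i) (X i) < X i \<omega>"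
      using AE_marginal_cdf_less_iff[of "X i" "VaR M (p i) (X i)"] X cont i by auto
  qed simp
  then show ?thesis
    using AE_space by eventually_elim (auto simp: stress_event_def)
qed

text \<open>Level 0 in the first coordinate is almost surely no constraint, since
  \<open>U\<^sub>1 > 0\<close> almost surely. This gives the normalising probability of the
  conditional law.\<close>

lemma joint_tail_stress:
  "joint_tail n (copula M n X) (p(1 := 0)) = prob (stress_event M n p X)"
proof (rule joint_tail_copula[OF X cont])
  have ins: "{1..n} = insert 1 {2..n}" using n by auto
  have pos: "AE \<omega> in M. 0 < marginal_cdf M (X 1) (X 1 \<omega>)"
    using n X cont by (intro AE_marginal_cdf_pos) auto
  show "AE \<omega> in M. (\<forall>i\<in>{1..n}. (p(1 := 0)) i < marginal_cdf M (X i) (X i \<omega>))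
      \<longleftrightarrow> \<omega> \<in> stress_event M n p X"
    using AE_stress_event_iff pos by eventually_elim (auto simp: ins simp del: One_nat_def)
qed (auto intro: stress_event_sets X)

text \<open>Level \<open>F\<^sub>1(t)\<close> in the first coordinate stands for
  \<open>X\<^sub>1 > t\<close>, which gives the numerator of the conditional tail at
  \<open>t\<close>.\<close>

lemma joint_tail_stress_Int:
  "joint_tail n (copula M n X) (p(1 := marginal_cdf M (X 1) t)) =
    prob (stress_event M n p X \<inter> {\<omega> \<in> space M. t < X 1 \<omega>})"
proof (rule joint_tail_copula[OF X cont])
  have ins: "{1..n} = insert 1 {2..n}" using n by auto
  have less: "AE \<omega> in M. marginal_cdf M (X 1) t < marginal_cdf M (X 1) (X 1 \<omega>) \<longleftrightarrow> t < X 1 \<omega>"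
    using n X cont by (intro AE_marginal_cdf_less_iff) auto
  show "AE \<omega> in M. (\<forall>i\<in>{1..n}. (p(1 := marginal_cdf M (X 1) t)) i
        < marginal_cdf M (X i) (X i \<omega>))
      \<longleftrightarrow> \<omega> \<in> stress_event M n p X \<inter> {\<omega> \<in> space M. t < X 1 \<omega>}"
    using AE_stress_event_iff less AE_space
    by eventually_elim (auto simp: ins simp del: One_nat_def)
  have "random_variable borel (X 1)" using n X by auto
  then show "stress_event M n p X \<inter> {\<omega> \<in> space M. t < X 1 \<omega>} \<in> events"
    by (intro sets.Int stress_event_sets X) auto
qed

end

end

section \<open>Conditional expectations and the final comparison\<close>

lemma integrable_uniform_measure:
  fixes f :: "'a \<Rightarrow> real"
  assumes f: "integrable M f" and A[measurable]: "A \<in> sets M" and pos: "0 < measure M A"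
  shows "integrable (uniform_measure M A) f"
proof -
  \<comment> \<open>\<open>measure\<close> is 0 by convention on sets of infinite
    \<open>emeasure\<close>, so positivity forces finiteness.\<close>
  have fin: "emeasure M A = ennreal (measure M A)"
    using pos by (metis emeasure_eq_ennreal_measure measure_zero_top order_less_irrefl)
  have "uniform_measure M A = density M (\<lambda>x. ennreal (indicator A x / measure M A))"
    unfolding uniform_measure_def
    by (intro density_cong) (auto simp: fin indicator_def pos divide_ennreal simp flip: ennreal_1)
  moreover have "integrable M (\<lambda>x. (indicator A x / measure M A) *\<^sub>R f x)"
    using integrable_mult_right[OF integrable_mult_indicator[OF A f], of "1 / measure M A"]
    by simp
  ultimately show ?thesis
    using f by (simp add: integrable_density)
qed

theorem theorem3p9:
  fixes M :: "'a measure" and N :: "'b measure"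
    and n :: nat
    and X :: "nat \<Rightarrow> 'a \<Rightarrow> real" and Y :: "nat \<Rightarrow> 'b \<Rightarrow> real"
    and f g :: "(nat \<Rightarrow> real) \<Rightarrow> ennreal"
    and a p :: "nat \<Rightarrow> real"
  assumes "prob_space M" and "prob_space N"
    and "n \<ge> 2"
    and "distributed M (\<Pi>\<^sub>M i\<in>{1..n}. lborel) (random_vec n X) f"
    and "distributed N (\<Pi>\<^sub>M i\<in>{1..n}. lborel) (random_vec n Y) g"
    and "\<And>i. i \<in> {1..n} \<Longrightarrow> distr M borel (X i) = distr N borel (Y i)"
    and "\<And>i. i \<in> {1..n} \<Longrightarrow> continuous_on UNIV (marginal_cdf M (X i))"
    and "\<And>i. i \<in> {1..n} \<Longrightarrow> integrable M (X i)"
    and "\<And>i. i \<in> {1..n} \<Longrightarrow> integrable N (Y i)"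
    and "\<And>i. i \<in> {2..n} \<Longrightarrow> a i \<in> {0..1}"
    and "(\<Sum>i=2..n. a i) = 1"
    and "whr_le n (copula M n X) (copula N n Y)"
    and "\<And>i. i \<in> {2..n} \<Longrightarrow> p i \<in> {0<..<1}"
    and "measure M (stress_event M n p X) > 0"
    and "measure N (stress_event N n p Y) > 0"
    and "mean_excess M n a p X \<noteq> 0"
  shows "Delta_R_MMME M n a p X \<le> Delta_R_MMME N n a p Y"
proof -
  interpret M: prob_space M by fact
  interpret N: prob_space N by fact
  note n = \<open>n \<ge> 2\<close> and p = assms(13)
  have XM: "X i \<in> borel_measurable M" if "i \<in> {1..n}" for i using assms(8)[OF that] by simp
  have YN: "Y i \<in> borel_measurable N" if "i \<in> {1..n}" for i using assms(9)[OF that] by simp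
  have one: "1 \<in> {1..n}" using n by simp
  note [measurable] = XM[OF one] YN[OF one]
  have cdf_eq: "marginal_cdf N (Y i) = marginal_cdf M (X i)" if "i \<in> {1..n}" for i
    using assms(6)[OF that] by (simp add: marginal_cdf_def)
  have contY: "continuous_on UNIV (marginal_cdf N (Y i))" if "i \<in> {1..n}" for i
    using assms(7)[OF that] cdf_eq[OF that] by simp
  define T where "T = threshold M n a p X"
  have T: "threshold N n a p Y = T"
    unfolding T_def threshold_def VaR_def by (intro sum.cong) (auto simp: cdf_eq)
  \<comment> \<open>Both unconditional mean excesses integrate the same function against the common
    law of the first components.\<close>
  have "(\<integral>x. max 0 (x - T) \<partial>distr M borel (X 1)) = (\<integral>x. max 0 (x - T) \<partial>distr N borel (Y 1))"
    by (simp only: assms(6)[OF one])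
  then have mean: "mean_excess N n a p Y = mean_excess M n a p X"
    unfolding mean_excess_def T T_def[symmetric]
    by (simp add: integral_distr[OF XM[OF one]] integral_distr[OF YN[OF one]] del: One_nat_def)
  have mean_nonneg: "0 \<le> mean_excess M n a p X"
    unfolding mean_excess_def by (intro integral_nonneg_AE) auto
  define S where "S = stress_event M n p X"
  define R where "R = stress_event N n p Y"
  have S[measurable]: "S \<in> sets M" unfolding S_def by (rule M.stress_event_sets[OF XM])
  have R[measurable]: "R \<in> sets N" unfolding R_def by (rule N.stress_event_sets[OF YN])
  have Spos: "0 < measure M S" and Rpos: "0 < measure N R"
    using assms(14,15) by (simp_all add: S_def R_def)
  have tail: "measure M (S \<inter> {\<omega> \<in> space M. t < X 1 \<omega>}) / measure M S
      \<le> measure N (R \<inter> {\<omega> \<in> space N. t < Y 1 \<omega>}) / measure N R" for t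
  \<comment> \<open>The order \<open>whr_le\<close> compares ratios only where the first joint tail
    is positive. If it vanishes at the upper point, the left side here is 0.\<close>
  proof (cases "measure M (S \<inter> {\<omega> \<in> space M. t < X 1 \<omega>}) = 0")
    case True
    then show ?thesis by simp
  next
    case False
    let ?q = "p(1 := marginal_cdf M (X 1) t)"
    interpret D: real_distribution "distr M borel (X 1)"
      using XM[OF one] by (rule M.real_distribution_distr)
    have t: "marginal_cdf M (X 1) t \<in> {0..1}"
      unfolding marginal_cdf_def using D.cdf_nonneg D.cdf_bounded_prob by auto
    have p01: "p i \<in> {0..1}" if "i \<in> {1..n}" "i \<noteq> 1" for i
      using p[of i] that by auto
    have tail_eq1: "joint_tail n (copula M n X) (p(1 := 0)) = measure M S"
      unfolding S_def by (rule M.joint_tail_stress[OF n XM assms(7) p])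
    have tail_eq2: "joint_tail n (copula N n Y) (p(1 := 0)) = measure N R"
      unfolding R_def by (rule N.joint_tail_stress[OF n YN contY p])
    have tail_eq3: "joint_tail n (copula M n X) ?q = measure M (S \<inter> {\<omega> \<in> space M. t < X 1 \<omega>})"
      unfolding S_def by (rule M.joint_tail_stress_Int[OF n XM assms(7) p])
    have tail_eq4: "joint_tail n (copula N n Y) ?q = measure N (R \<inter> {\<omega> \<in> space N. t < Y 1 \<omega>})"
      unfolding R_def cdf_eq[OF one, symmetric] by (rule N.joint_tail_stress_Int[OF n YN contY p])
    have pos: "0 < measure M (S \<inter> {\<omega> \<in> space M. t < X 1 \<omega>})"
      using False by (simp add: zero_less_measure_iff)
    have range: "\<forall>i\<in>{1..n}. (p(1 := 0)) i \<in> {0..1} \<and> ?q i \<in> {0..1} \<and> (p(1 := 0)) i \<le> ?q i"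
      using t p01 by auto
    have "measure N R / measure M S \<le>
        measure N (R \<inter> {\<omega> \<in> space N. t < Y 1 \<omega>}) / measure M (S \<inter> {\<omega> \<in> space M. t < X 1 \<omega>})"
      using assms(12)[unfolded whr_le_def, rule_format, of "p(1 := 0)" ?q] range pos Spos
      unfolding tail_eq1 tail_eq2 tail_eq3 tail_eq4 by blast
    \<comment> \<open>Cross-multiplying by the positive probabilities turns ratios between the two
      vectors into conditional probabilities of each vector.\<close>
    then show ?thesis using pos Spos Rpos by (simp add: field_simps)
  qed
  have "MMME M n a p X \<le> MMME N n a p Y"
    unfolding MMME_def T T_def[symmetric] S_def[symmetric] R_def[symmetric]
  proof (rule integral_mono_stochastic)
    show "prob_space (uniform_measure M S)" "prob_space (uniform_measure N R)"
      using Spos Rpos by (auto intro!: prob_space_uniform_measure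
        simp: M.emeasure_eq_measure N.emeasure_eq_measure)
    show "(\<lambda>\<omega>. max 0 (X 1 \<omega> - T)) \<in> borel_measurable (uniform_measure M S)"
      using XM[OF one] by (subst measurable_cong_sets[OF sets_uniform_measure refl]) measurable
    show "integrable (uniform_measure N R) (\<lambda>\<omega>. max 0 (Y 1 \<omega> - T))"
      using assms(9)[OF one] by (intro integrable_uniform_measure[OF _ R Rpos]) auto
    fix t :: real assume t: "0 \<le> t"
    have *: "{\<omega> \<in> space M. t < max 0 (X 1 \<omega> - T)} = {\<omega> \<in> space M. t + T < X 1 \<omega>}"
      "{\<omega> \<in> space N. t < max 0 (Y 1 \<omega> - T)} = {\<omega> \<in> space N. t + T < Y 1 \<omega>}"
      using t by auto
    show "measure (uniform_measure M S) {\<omega> \<in> space (uniform_measure M S). t < max 0 (X 1 \<omega> - T)}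
      \<le> measure (uniform_measure N R) {\<omega> \<in> space (uniform_measure N R). t < max 0 (Y 1 \<omega> - T)}"
      using tail[of "t + T"] Spos Rpos
      by (simp add: * measure_uniform_measure M.emeasure_eq_measure N.emeasure_eq_measure
        del: One_nat_def)
  qed auto
  \<comment> \<open>With a common mean excess that is nonnegative, the contribution ratio is
    increasing in \<open>MMME\<close>.\<close>
  then show ?thesis
    unfolding Delta_R_MMME_def mean using mean_nonneg by (intro divide_right_mono) auto
qed

end
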